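(* Denote by $u$ the vertex of $A(mK_n,K_1)$ common to all $m$ copies of $K_n$. (a) If $m,n\ge 2$, then $\chi_{la}(A(mK_n,K_1)\vee K_1)=n+1$. (b) If $m\ge 2$ and $e$ is an edge of $A(mK_2,K_1)$, then $\chi_{la}((A(mK_2,K_1)-e)\vee K_1)=3$. (c) If $m\ge 2$, $n\ge 3$ and $e$ is an edge of $A(mK_n,K_1)$ that is not incident to $u$, then $\chi_{la}((A(mK_n,K_1)-e)\vee K_1)=n+1$. (d) If $m,n\ge 3$ and $e$ is an edge of $A(mK_n,K_1)$ that is incident to $u$, then $\chi_{la}((A(mK_n,K_1)-e)\vee K_1)=n+1$.
   Context: Graphs are finite and simple. For $m,n\ge 2$, $A(mK_n,K_1)$ is the one-point union (amalgamation) of $m$ copies of $K_n$: the graph obtained from $m$ disjoint copies of $K_n$ by identifying one vertex from each copy into a single common vertex. $G-e$ is $G$ with the edge $e$ deleted (keeping all vertices). $G\vee K_1$ is obtained from $G$ by adding one new vertex adjacent to every vertex of $G$. A local antimagic labeling of a graph $H$ of size $q$ is a bijection $g:E(H)\to\{1,\ldots,q\}$ such that $g^+(x)\ne g^+(y)$ for every edge $xy$ of $H$, where $g^+(x)=\sum_{xz\in E(H)}g(xz)$; $\chi_{la}(H)$ is the minimum number of distinct values of $g^+$ over all local antimagic labelings $g$ of $H$. *)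

theory Defs
  imports Complex_Main
begin

section \<open>Finite simple graphs\<close>

record 'a graph =
  verts :: "'a set"
  edges :: "'a set set"

definition simple_graph :: "'a graph \<Rightarrow> bool" where
  "simple_graph G \<longleftrightarrow> finite (verts G) \<and> (\<forall>e\<in>edges G. e \<subseteq> verts G \<and> card e = 2)"

definition complete_graph :: "nat \<Rightarrow> nat graph" where
  "complete_graph n = \<lparr>verts = {..<n}, edges = {{i, j} | i j. i < n \<and> j < n \<and> i \<noteq> j}\<rparr>"

definition map_graph :: "('a \<Rightarrow> 'b) \<Rightarrow> 'a graph \<Rightarrow> 'b graph" where
  "map_graph f G = \<lparr>verts = f ` verts G, edges = (\<lambda>e. f ` e) ` edges G\<rparr>"

definition copies :: "nat \<Rightarrow> 'a graph \<Rightarrow> (nat \<times> 'a) graph" where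
  "copies m G = \<lparr>verts = {..<m} \<times> verts G, edges = {Pair i ` e | i e. i < m \<and> e \<in> edges G}\<rparr>"

text \<open>The vertices \<open>(i, r)\<close>, \<open>i < m\<close>, of the disjoint union of \<open>m\<close> copies of \<open>G\<close> are all
  identified with \<open>(0, r)\<close>; for \<open>m \<ge> 1\<close> the common vertex is thus represented by \<open>(0, r)\<close>.\<close>

definition one_point_union :: "nat \<Rightarrow> 'a graph \<Rightarrow> 'a \<Rightarrow> (nat \<times> 'a) graph" where
  "one_point_union m G r = map_graph (\<lambda>(i, v). if v = r then (0, r) else (i, v)) (copies m G)"

text \<open>\<open>A(mK\<^sub>n, K\<^sub>1)\<close>. As \<open>K\<^sub>n\<close> is vertex-transitive, the choice of the identified vertex does not
  matter; it is vertex \<open>0\<close> of each copy.\<close>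

definition amalgamation :: "nat \<Rightarrow> nat \<Rightarrow> (nat \<times> nat) graph" where
  "amalgamation m n = one_point_union m (complete_graph n) 0"

definition common_vertex :: "nat \<times> nat" where
  "common_vertex = (0, 0)"

definition delete_edge :: "'a graph \<Rightarrow> 'a set \<Rightarrow> 'a graph" where
  "delete_edge G e = \<lparr>verts = verts G, edges = edges G - {e}\<rparr>"

text \<open>In the join with \<open>K\<^sub>1\<close> the new vertex is \<open>None\<close>.\<close>

definition join_K1 :: "'a graph \<Rightarrow> 'a option graph" where
  "join_K1 G = \<lparr>verts = insert None (Some ` verts G),
     edges = (\<lambda>e. Some ` e) ` edges G \<union> {{None, Some v} | v. v \<in> verts G}\<rparr>"


section \<open>Local antimagic labelings\<close>

definition vertex_sum :: "'a graph \<Rightarrow> ('a set \<Rightarrow> nat) \<Rightarrow> 'a \<Rightarrow> nat" where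
  "vertex_sum H g x = (\<Sum>z | {x, z} \<in> edges H. g {x, z})"

definition local_antimagic :: "'a graph \<Rightarrow> ('a set \<Rightarrow> nat) \<Rightarrow> bool" where
  "local_antimagic H g \<longleftrightarrow> bij_betw g (edges H) {1..card (edges H)} \<and>
     (\<forall>x y. {x, y} \<in> edges H \<longrightarrow> vertex_sum H g x \<noteq> vertex_sum H g y)"

text \<open>The infimum of a nonempty set of natural numbers is its minimum. If \<open>H\<close> has no local
  antimagic labeling the set is empty and its infimum is \<open>0\<close>, so for a graph with at least one
  vertex, \<open>chi_la H = k\<close> with \<open>k > 0\<close> includes the existence of such a labeling.\<close>

definition chi_la :: "'a graph \<Rightarrow> nat" where
  "chi_la H = Inf {card (vertex_sum H g ` verts H) | g. local_antimagic H g}"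


section \<open>The constructions yield finite simple graphs\<close>

lemma simple_complete_graph: "simple_graph (complete_graph n)"
  by (auto simp: simple_graph_def complete_graph_def)

lemma simple_delete_edge: "simple_graph G \<Longrightarrow> simple_graph (delete_edge G e)"
  by (auto simp: simple_graph_def delete_edge_def)

lemma simple_join_K1:
  assumes "simple_graph G"
  shows "simple_graph (join_K1 G)"
  using assms by (auto simp: simple_graph_def join_K1_def card_image)

lemma simple_one_point_union:
  assumes "simple_graph G"
  shows "simple_graph (one_point_union m G r)"
proof -
  let ?f = "\<lambda>(i::nat, v). if v = r then (0, r) else (i, v)"
  have fin: "finite (verts (one_point_union m G r))"
    using assms by (simp add: simple_graph_def one_point_union_def map_graph_def copies_def)
  have "card e' = 2 \<and> e' \<subseteq> verts (one_point_union m G r)"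
    if "e' \<in> edges (one_point_union m G r)" for e'
  proof -
    from that obtain i e where e: "i < m" "e \<in> edges G" "e' = ?f ` Pair i ` e"
      by (auto simp: one_point_union_def map_graph_def copies_def)
    have "inj_on (\<lambda>v. ?f (i, v)) e"
      by (auto simp: inj_on_def split: if_splits)
    then have "card e' = 2"
      using assms e by (simp only: image_image card_image) (simp add: simple_graph_def)
    moreover have "Pair i ` e \<subseteq> {..<m} \<times> verts G"
      using assms e by (auto simp: simple_graph_def)
    then have "e' \<subseteq> verts (one_point_union m G r)"
      unfolding e(3) by (simp add: one_point_union_def map_graph_def copies_def image_mono)
    ultimately show ?thesis
      by simp
  qed
  with fin show ?thesis
    by (simp add: simple_graph_def)
qed

lemma simple_amalgamation: "simple_graph (amalgamation m n)"
  by (simp add: amalgamation_def simple_one_point_union simple_complete_graph)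

lemma verts_amalgamation:
  assumes "m \<ge> 1" "n \<ge> 1"
  shows "verts (amalgamation m n) = insert common_vertex ({..<m} \<times> {1..<n})"
proof -
  have "common_vertex \<in> verts (amalgamation m n)"
    using assms
    by (auto simp: amalgamation_def one_point_union_def map_graph_def copies_def
        complete_graph_def common_vertex_def intro!: image_eqI[of _ _ "(0, 0)"])
  moreover have "(i, v) \<in> verts (amalgamation m n)" if "i < m" "1 \<le> v" "v < n" for i v
    using that
    by (auto simp: amalgamation_def one_point_union_def map_graph_def copies_def
        complete_graph_def intro!: image_eqI[of _ _ "(i, v)"])
  moreover have "verts (amalgamation m n) \<subseteq> insert common_vertex ({..<m} \<times> {1..<n})"
    by (auto simp: amalgamation_def one_point_union_def map_graph_def copies_def
        complete_graph_def common_vertex_def split: if_splits)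
  ultimately show ?thesis
    by auto
qed

end

theory Submission
  imports Defs "HOL-Library.Nat_Bijection" "HOL-Combinatorics.Transposition"
begin

text \<open>
  Joining \<open>A(mK\<^sub>n, K\<^sub>1)\<close> with \<open>K\<^sub>1\<close> gives \<open>m\<close> complete graphs on \<open>n + 1\<close> vertices that share the edge from
  \<open>u\<close> to the new vertex. Call this graph a book: each page has \<open>k = n - 1\<close> inner vertices \<open>0, \<dots>, k - 1\<close>,
  and the two ends of the shared edge are the hubs \<open>k\<close> and \<open>k + 1\<close>. Deleting an edge other than the
  shared one leaves another page complete, and the vertices of a clique have distinct sums, so
  \<open>n + 1\<close> is a lower bound in all cases. It is attained by a labeling in which the sum at a vertex
  depends on its position \<open>a \<le> k + 1\<close> only and not on its page.

  One construction serves all parts, because it uses the labels \<open>0, \<dots>, q - 1\<close> instead of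
  \<open>1, \<dots>, q\<close>. The edge labeled \<open>0\<close> can be deleted without changing any sum, and what remains is a
  labeling by \<open>1, \<dots>, q - 1\<close>. Conversely, adding \<open>1\<close> to all labels adds its degree to each sum; the
  sums increase with the position, and so do the degrees, hence the sums stay distinct. Since all
  pages, all inner positions and both hubs look alike, only two places for the label \<open>0\<close> are
  needed: an edge between inner vertices and an edge from an inner vertex to a hub.

  For a pair \<open>a < b \<le> k\<close> the \<open>m\<close> edges joining the positions \<open>a\<close> and \<open>b\<close> get a block of \<open>m\<close>
  consecutive labels, ascending or descending with the page number; the blocks are ordered
  colexicographically, the labels at hub \<open>k + 1\<close> come after them, and the shared edge is last. The
  sum at an inner vertex is then a linear function of the page number and it remains to make its
  slope vanish. Let the block of \<open>a < b\<close> ascend if \<open>a + b\<close> is odd and descend otherwise: among an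
  even number of positions \<open>0, \<dots>, K - 1\<close> this gives every vertex the slope \<open>1\<close>, since the diagonal
  term \<open>-1\<close> is missing from an alternating sum (\<open>sum_alternating_remove\<close>). For odd \<open>k\<close> take
  \<open>K = k + 1\<close> and compensate by descending blocks at hub \<open>k + 1\<close>. For even \<open>k\<close> take \<open>K = k\<close>; ascending
  blocks at hub \<open>k\<close> raise the slope to \<open>2\<close>, and the blocks at hub \<open>k + 1\<close> are interleaved in pairs,
  so that their labels descend in steps of \<open>2\<close> (\<open>sum_slope\<close>).

  The sums increase with the position: the order of the blocks makes the labels at an inner
  position smaller than the corresponding ones at a later inner position, and since \<open>m \<ge> 2\<close> the hubs
  collect labels from a second page (\<open>colour_strict_mono\<close>).
\<close>

section \<open>Local antimagic labelings of general graphs\<close>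

text \<open>The vertices of a clique have distinct sums under every local antimagic labeling, which is the
  lower bound.\<close>

lemma chi_la_eqI:
  assumes "finite (verts H)" and g: "local_antimagic H g"
    and few: "card (vertex_sum H g ` verts H) \<le> card C"
    and C: "C \<subseteq> verts H" "\<And>x y. x \<in> C \<Longrightarrow> y \<in> C \<Longrightarrow> x \<noteq> y \<Longrightarrow> {x, y} \<in> edges H"
  shows "chi_la H = card C"
proof -
  have lower: "card C \<le> card (vertex_sum H g' ` verts H)" if "local_antimagic H g'" for g'
  proof -
    have "inj_on (vertex_sum H g') C"
      using that C(2) by (auto simp: local_antimagic_def inj_on_def)
    then have "card C = card (vertex_sum H g' ` C)"
      by (simp add: card_image)
    also have "\<dots> \<le> card (vertex_sum H g' ` verts H)"
      using assms(1) C(1) by (intro card_mono) auto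
    finally show ?thesis .
  qed
  have "card (vertex_sum H g ` verts H) = card C"
    using lower[OF g] few by simp
  then show ?thesis
    unfolding chi_la_def using g lower by (intro cInf_eq_minimum) (auto 0 4 intro: exI[of _ g])
qed

lemma vertex_sum_cong:
  assumes "\<And>e. e \<in> edges G \<Longrightarrow> g e = g' e"
  shows "vertex_sum G g = vertex_sum G g'"
  using assms by (auto simp: vertex_sum_def fun_eq_iff intro!: sum.cong)

lemma local_antimagic_cong:
  assumes "\<And>e. e \<in> edges G \<Longrightarrow> g e = g' e"
  shows "local_antimagic G g \<longleftrightarrow> local_antimagic G g'"
  using bij_betw_cong[of "edges G" g g'] vertex_sum_cong[of G g g'] assms
  by (simp add: local_antimagic_def)

lemma inj_on_image_edges:
  assumes "simple_graph G" "inj_on f (verts G)"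
  shows "inj_on ((`) f) (edges G)"
proof (rule inj_onI)
  fix e e' assume "e \<in> edges G" "e' \<in> edges G" and eq: "f ` e = f ` e'"
  then have "e \<subseteq> verts G" "e' \<subseteq> verts G"
    using assms(1) by (auto simp: simple_graph_def)
  with assms(2) eq show "e = e'"
    by (simp add: inj_on_image_eq_iff)
qed

lemma edge_map_graph_iff:
  assumes "simple_graph G" "inj_on f (verts G)" "x \<in> verts G" "y \<in> verts G"
  shows "{f x, f y} \<in> edges (map_graph f G) \<longleftrightarrow> {x, y} \<in> edges G"
proof
  assume "{f x, f y} \<in> edges (map_graph f G)"
  then obtain e where e: "e \<in> edges G" "f ` e = f ` {x, y}"
    by (auto simp: map_graph_def)
  moreover have "e \<subseteq> verts G"
    using e assms(1) by (simp add: simple_graph_def)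
  ultimately show "{x, y} \<in> edges G"
    using assms inj_on_image_eq_iff[of f "verts G" e "{x, y}"] by auto
next
  assume "{x, y} \<in> edges G"
  then show "{f x, f y} \<in> edges (map_graph f G)"
    by (auto simp: map_graph_def intro!: image_eqI[of _ _ "{x, y}"])
qed

lemma edge_in_map_graphE:
  assumes "simple_graph G" "{x', y'} \<in> edges (map_graph f G)"
  obtains x y where "x \<in> verts G" "y \<in> verts G" "x' = f x" "y' = f y"
proof -
  obtain e where "e \<in> edges G" "f ` e = {x', y'}"
    using assms by (auto simp: map_graph_def)
  moreover from this have "e \<subseteq> verts G"
    using assms by (simp add: simple_graph_def)
  moreover have "x' \<in> f ` e" "y' \<in> f ` e"
    using calculation by auto
  ultimately show ?thesis
    using that by blast
qed

lemma vertex_sum_map_graph: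
  assumes G: "simple_graph G" "inj_on f (verts G)" and x: "x \<in> verts G"
  shows "vertex_sum (map_graph f G) g (f x) = vertex_sum G (\<lambda>e. g (f ` e)) x"
proof -
  have nb: "z \<in> verts G" if "{x, z} \<in> edges G" for z
    using that G by (auto simp: simple_graph_def)
  have "{z'. {f x, z'} \<in> edges (map_graph f G)} = f ` {z. {x, z} \<in> edges G}"
  proof (intro set_eqI iffI)
    fix z' assume "z' \<in> {z'. {f x, z'} \<in> edges (map_graph f G)}"
    moreover from this obtain z where "z \<in> verts G" "z' = f z"
      using G(1) by (auto elim: edge_in_map_graphE)
    ultimately show "z' \<in> f ` {z. {x, z} \<in> edges G}"
      using edge_map_graph_iff[OF G x] by auto
  qed (use edge_map_graph_iff[OF G x] nb in auto)
  moreover have "inj_on f {z. {x, z} \<in> edges G}"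
    using G(2) nb by (auto intro: inj_on_subset)
  ultimately show ?thesis
    by (simp add: vertex_sum_def sum.reindex)
qed

lemma local_antimagic_map_graph:
  assumes G: "simple_graph G" "inj_on f (verts G)"
  shows "local_antimagic (map_graph f G) g \<longleftrightarrow> local_antimagic G (\<lambda>e. g (f ` e))"
proof -
  note inj = inj_on_image_edges[OF G]
  have card: "card (edges (map_graph f G)) = card (edges G)"
    using inj by (simp add: map_graph_def card_image)
  have "bij_betw ((`) f) (edges G) (edges (map_graph f G))"
    using inj by (simp add: map_graph_def bij_betw_def)
  from bij_betw_comp_iff[OF this, of g]
  have bij: "bij_betw g (edges (map_graph f G)) B \<longleftrightarrow> bij_betw (\<lambda>e. g (f ` e)) (edges G) B" for B
    by (simp add: comp_def)
  have "(\<forall>x' y'. {x', y'} \<in> edges (map_graph f G) \<longrightarrow>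
           vertex_sum (map_graph f G) g x' \<noteq> vertex_sum (map_graph f G) g y') \<longleftrightarrow>
        (\<forall>x y. {x, y} \<in> edges G \<longrightarrow>
           vertex_sum G (\<lambda>e. g (f ` e)) x \<noteq> vertex_sum G (\<lambda>e. g (f ` e)) y)" (is "?L \<longleftrightarrow> ?R")
  proof
    assume L: ?L
    show ?R
    proof (intro allI impI)
      fix x y assume xy: "{x, y} \<in> edges G"
      then have "x \<in> verts G" "y \<in> verts G"
        using G by (auto simp: simple_graph_def)
      then show "vertex_sum G (\<lambda>e. g (f ` e)) x \<noteq> vertex_sum G (\<lambda>e. g (f ` e)) y"
        using L xy by (metis edge_map_graph_iff[OF G] vertex_sum_map_graph[OF G])
    qed
  next
    assume R: ?R
    show ?L
    proof (intro allI impI)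
      fix x' y' assume xy: "{x', y'} \<in> edges (map_graph f G)"
      then obtain x y where "x \<in> verts G" "y \<in> verts G" "x' = f x" "y' = f y"
        using G(1) by (auto elim: edge_in_map_graphE)
      then show "vertex_sum (map_graph f G) g x' \<noteq> vertex_sum (map_graph f G) g y'"
        using R xy by (simp add: edge_map_graph_iff[OF G] vertex_sum_map_graph[OF G])
    qed
  qed
  then show ?thesis
    by (simp add: local_antimagic_def card bij)
qed

text \<open>Pulling labelings back along \<open>f\<close> is a surjection from the labelings of the image onto those of
  \<open>G\<close>, up to values on non-edges, and it preserves the set of sums.\<close>

lemma chi_la_map_graph:
  assumes G: "simple_graph G" "inj_on f (verts G)"
  shows "chi_la (map_graph f G) = chi_la G"
proof -
  have sums: "vertex_sum (map_graph f G) g ` verts (map_graph f G)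
      = vertex_sum G (\<lambda>e. g (f ` e)) ` verts G" for g
  proof -
    have "vertex_sum (map_graph f G) g ` verts (map_graph f G)
      = (\<lambda>x. vertex_sum (map_graph f G) g (f x)) ` verts G"
      by (simp add: map_graph_def image_image)
    also have "\<dots> = vertex_sum G (\<lambda>e. g (f ` e)) ` verts G"
      by (intro image_cong) (simp_all add: vertex_sum_map_graph[OF G])
    finally show ?thesis .
  qed
  have "\<exists>g'. local_antimagic (map_graph f G) g' \<and>
      vertex_sum G g = vertex_sum G (\<lambda>e. g' (f ` e))" if "local_antimagic G g" for g
  proof -
    define g' where "g' = (\<lambda>e'. g (the_inv_into (edges G) ((`) f) e'))"
    have eq: "g e = g' (f ` e)" if "e \<in> edges G" for e
      using that inj_on_image_edges[OF G] by (simp add: g'_def the_inv_into_f_f)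
    have "local_antimagic (map_graph f G) g'"
      using local_antimagic_cong[of G g "\<lambda>e. g' (f ` e)"] eq that
      by (simp add: local_antimagic_map_graph[OF G])
    with vertex_sum_cong[of G g "\<lambda>e. g' (f ` e)"] eq show ?thesis
      by blast
  qed
  then have "card (vertex_sum G g ` verts G) \<in>
      {card (vertex_sum (map_graph f G) g' ` verts (map_graph f G)) | g'. local_antimagic (map_graph f G) g'}"
    if "local_antimagic G g" for g
    using that unfolding sums by (smt (verit) mem_Collect_eq)
  then have "{card (vertex_sum (map_graph f G) g ` verts (map_graph f G)) | g.
        local_antimagic (map_graph f G) g} = {card (vertex_sum G g ` verts G) | g. local_antimagic G g}"
    unfolding sums local_antimagic_map_graph[OF G] by blast
  then show ?thesis
    by (simp add: chi_la_def)
qed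

lemma delete_edge_map_graph:
  assumes G: "simple_graph G" "inj_on f (verts G)" and e: "e \<in> edges G"
  shows "delete_edge (map_graph f G) (f ` e) = map_graph f (delete_edge G e)"
proof -
  have "(`) f ` (edges G - {e}) = (`) f ` edges G - (`) f ` {e}"
    by (rule inj_on_image_set_diff[OF inj_on_image_edges[OF G]]) (use e in auto)
  then show ?thesis
    by (simp add: delete_edge_def map_graph_def)
qed

lemma delete_edge_join_K1:
  "join_K1 (delete_edge G e) = delete_edge (join_K1 G) (Some ` e)"
proof -
  have "(`) Some ` (edges G - {e}) = (`) Some ` edges G - (`) Some ` {e}"
    by (rule image_set_diff) (simp add: inj_image_eq_iff inj_def)
  moreover have "Some ` e \<notin> {{None, Some v} | v. v \<in> verts G}"
    by (auto simp: set_eq_iff image_iff)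
  ultimately show ?thesis
    by (simp add: delete_edge_def join_K1_def Un_Diff)
qed

lemma bij_betw_delete_zero:
  assumes f: "bij_betw f E {..<card E}" and e: "e \<in> E" "f e = (0::nat)"
  shows "bij_betw f (E - {e}) {1..card (E - {e})}"
proof -
  have fin: "finite E"
    using f bij_betw_finite by blast
  have "bij_betw f (E - {e}) ({..<card E} - {0})"
    using bij_betw_DiffI[OF f, of "{e}" "{0}"] e bij_betwE[OF f] by force
  moreover have "{..<card E} - {0} = {1..card (E - {e})}"
    using fin e by (auto simp: card_Diff_singleton)
  ultimately show ?thesis
    by simp
qed

text \<open>Together with \<open>bij_betw_delete_zero\<close>: from a labeling by \<open>0, \<dots>, q - 1\<close> the edge labeled \<open>0\<close> may
  be removed at no cost.\<close>

lemma vertex_sum_delete_zero: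
  assumes "simple_graph G" "f e = 0"
  shows "vertex_sum (delete_edge G e) f x = vertex_sum G f x"
proof -
  have "{z. {x, z} \<in> edges G} \<subseteq> verts G"
    using assms by (auto simp: simple_graph_def)
  then have "finite {z. {x, z} \<in> edges G}"
    using assms finite_subset by (auto simp: simple_graph_def)
  then show ?thesis
    unfolding vertex_sum_def using assms(2)
    by (intro sum.mono_neutral_left) (auto simp: delete_edge_def)
qed

lemma vertex_sum_Suc:
  "vertex_sum G (\<lambda>e. Suc (f e)) x = vertex_sum G f x + card {z. {x, z} \<in> edges G}"
  by (simp add: vertex_sum_def sum.distrib[of _ "\<lambda>_. 1::nat", simplified])

section \<open>Cliques glued along an edge\<close>

text \<open>Position \<open>a\<close> on page \<open>i\<close>; the positions \<open>k\<close> and \<open>k + 1\<close> are the hubs, which all pages share and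
  which are therefore put on page \<open>0\<close>.\<close>

definition page_vertex :: "nat \<Rightarrow> nat \<Rightarrow> nat \<Rightarrow> nat \<times> nat" where
  "page_vertex k i a = (if a < k then (i, a) else (0, a))"

definition clique_book :: "nat \<Rightarrow> nat \<Rightarrow> (nat \<times> nat) graph" where
  "clique_book m k = \<lparr>verts = {page_vertex k i a | i a. i < m \<and> a < k + 2},
     edges = {{page_vertex k i a, page_vertex k i b} | i a b. i < m \<and> a < b \<and> b < k + 2}\<rparr>"

lemma page_vertex_eq_iff:
  "page_vertex k i a = page_vertex k j b \<longleftrightarrow> a = b \<and> (a < k \<longrightarrow> i = j)"
  by (auto simp: page_vertex_def)

lemma page_vertex_in_verts: "i < m \<Longrightarrow> a < k + 2 \<Longrightarrow> page_vertex k i a \<in> verts (clique_book m k)"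
  by (auto simp: clique_book_def)

lemma edge_clique_book:
  assumes "i < m" "a < k + 2" "b < k + 2" "a \<noteq> b"
  shows "{page_vertex k i a, page_vertex k i b} \<in> edges (clique_book m k)"
proof (cases "a < b")
  case True
  then show ?thesis
    using assms by (auto simp: clique_book_def)
next
  case False
  then have "b < a"
    using assms by simp
  then have "{page_vertex k i b, page_vertex k i a} \<in> edges (clique_book m k)"
    using assms by (auto simp: clique_book_def)
  then show ?thesis
    by (simp add: insert_commute)
qed

lemma simple_clique_book: "simple_graph (clique_book m k)"
proof -
  have "finite ((\<lambda>(i, a). page_vertex k i a) ` ({..<m} \<times> {..<k + 2}))"
    by simp
  also have "(\<lambda>(i, a). page_vertex k i a) ` ({..<m} \<times> {..<k + 2}) = verts (clique_book m k)"
    by (auto simp: clique_book_def)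
  finally have "finite (verts (clique_book m k))" .
  moreover have "e \<subseteq> verts (clique_book m k) \<and> card e = 2" if "e \<in> edges (clique_book m k)" for e
  proof -
    from that obtain i a b where e: "e = {page_vertex k i a, page_vertex k i b}" "i < m" "a < b" "b < k + 2"
      by (auto simp: clique_book_def)
    then have "page_vertex k i a \<noteq> page_vertex k i b"
      by (simp add: page_vertex_eq_iff)
    then have "card e = 2"
      by (simp add: e)
    moreover have "page_vertex k i a \<in> verts (clique_book m k)" "page_vertex k i b \<in> verts (clique_book m k)"
      using e by (auto intro!: page_vertex_in_verts)
    ultimately show ?thesis
      using e by simp
  qed
  ultimately show ?thesis
    by (simp add: simple_graph_def)
qed

lemma edge_clique_bookE:
  assumes "{x, y} \<in> edges (clique_book m k)"
  obtains i a b where "i < m" "a < k + 2" "b < k + 2" "a \<noteq> b"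
    "x = page_vertex k i a" "y = page_vertex k i b"
proof -
  obtain i a b where *: "{x, y} = {page_vertex k i a, page_vertex k i b}" "i < m" "a < b" "b < k + 2"
    using assms by (auto simp: clique_book_def)
  then consider "x = page_vertex k i a" "y = page_vertex k i b" | "x = page_vertex k i b" "y = page_vertex k i a"
    by (auto simp: doubleton_eq_iff)
  then show ?thesis
  proof cases
    case 1
    then show ?thesis
      using * that[of i a b] by simp
  next
    case 2
    then show ?thesis
      using * that[of i b a] by simp
  qed
qed

lemma neighbours_inner:
  assumes "i < m" "v < k"
  shows "{z. {page_vertex k i v, z} \<in> edges (clique_book m k)} = page_vertex k i ` ({..<k + 2} - {v})"
  using assms edge_clique_book[of i m v k]
  by (auto elim!: edge_clique_bookE simp: page_vertex_eq_iff intro!: imageI)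

lemma neighbours_hub:
  assumes "m > 0" "c = k \<and> c' = Suc k \<or> c = Suc k \<and> c' = k"
  shows "{z. {page_vertex k j c, z} \<in> edges (clique_book m k)} = insert (0, c') ({..<m} \<times> {..<k})"
proof (intro set_eqI iffI)
  fix z assume "z \<in> {z. {page_vertex k j c, z} \<in> edges (clique_book m k)}"
  then show "z \<in> insert (0, c') ({..<m} \<times> {..<k})"
    using assms by (auto elim!: edge_clique_bookE simp: page_vertex_eq_iff) (auto simp: page_vertex_def)
next
  fix z assume "z \<in> insert (0, c') ({..<m} \<times> {..<k})"
  then consider "z = page_vertex k 0 c'" | i a where "z = page_vertex k i a" "i < m" "a < k"
    using assms(2) by (auto simp: page_vertex_def)
  then obtain i b where "z = page_vertex k i b" "i < m" "b < k + 2" "b \<noteq> c"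
  proof cases
    case 1
    with assms that[of 0 c'] show ?thesis by auto
  next
    case (2 i a)
    with assms that[of i a] show ?thesis by auto
  qed
  moreover have "page_vertex k j c = page_vertex k i c"
    using assms by (auto simp: page_vertex_def)
  ultimately show "z \<in> {z. {page_vertex k j c, z} \<in> edges (clique_book m k)}"
    using edge_clique_book[of i m c k b] assms by auto
qed

text \<open>The upper and the lower bound for a book from which edges have been removed so that some page
  \<open>j\<close> stays complete.\<close>

lemma chi_la_subgraph_clique_book:
  assumes V: "verts G = verts (clique_book m k)" and E: "edges G \<subseteq> edges (clique_book m k)"
    and bij: "bij_betw g (edges G) {1..card (edges G)}"
    and sums: "\<And>i a. i < m \<Longrightarrow> a < k + 2 \<Longrightarrow> vertex_sum G g (page_vertex k i a) = col a"
    and inj: "inj_on col {..<k + 2}"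
    and full: "j < m" "\<And>a b. a < b \<Longrightarrow> b < k + 2 \<Longrightarrow> {page_vertex k j a, page_vertex k j b} \<in> edges G"
  shows "chi_la G = k + 2"
proof -
  have la: "local_antimagic G g"
    unfolding local_antimagic_def
  proof (intro conjI allI impI bij)
    fix x y assume "{x, y} \<in> edges G"
    then have "{x, y} \<in> edges (clique_book m k)"
      using E by blast
    then show "vertex_sum G g x \<noteq> vertex_sum G g y"
      by (rule edge_clique_bookE) (use sums inj in \<open>auto simp: inj_on_def\<close>)
  qed
  have "vertex_sum G g ` verts G \<subseteq> col ` {..<k + 2}"
    using sums unfolding V by (auto simp: clique_book_def)
  then have "card (vertex_sum G g ` verts G) \<le> card (col ` {..<k + 2})"
    by (intro card_mono) auto
  also have "\<dots> \<le> k + 2"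
    using card_image_le[of "{..<k + 2}" col] by simp
  finally have few: "card (vertex_sum G g ` verts G) \<le> k + 2" .
  let ?C = "page_vertex k j ` {..<k + 2}"
  have C: "card ?C = k + 2"
    by (subst card_image) (auto simp: inj_on_def page_vertex_eq_iff)
  have "chi_la G = card ?C"
  proof (rule chi_la_eqI[OF _ la])
    show "finite (verts G)"
      using simple_clique_book[of m k] by (simp add: V simple_graph_def)
    show "card (vertex_sum G g ` verts G) \<le> card ?C"
      using few C by simp
    show "?C \<subseteq> verts G"
      using full by (auto simp: V clique_book_def)
    fix x y assume "x \<in> ?C" "y \<in> ?C" "x \<noteq> y"
    then obtain a b where ab: "x = page_vertex k j a" "y = page_vertex k j b" "a < k + 2" "b < k + 2" "a \<noteq> b"
      by auto
    then consider "a < b" | "b < a"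
      by linarith
    then show "{x, y} \<in> edges G"
      using ab full(2)[of a b] full(2)[of b a] by cases (auto simp: insert_commute)
  qed
  with C show ?thesis
    by simp
qed

section \<open>A labeling of the book by blocks of consecutive labels\<close>

text \<open>The number of pairs that precede \<open>a < b\<close> colexicographically. Up to a change of coordinates it is
  the Cantor pairing function, so that \<open>{(a, b). a < b \<le> k}\<close> is numbered by the naturals below
  \<open>triangle k\<close>.\<close>

definition pair_index :: "nat \<Rightarrow> nat \<Rightarrow> nat" where
  "pair_index a b = triangle (b - 1) + a"

lemma pair_index_eq_prod_encode: "a < b \<Longrightarrow> pair_index a b = prod_encode (a, b - Suc a)"
  by (simp add: pair_index_def prod_encode_def)

lemma pair_index_inject:
  assumes "a < b" "a' < b'" "pair_index a b = pair_index a' b'"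
  shows "a = a' \<and> b = b'"
  using assms by (auto simp: pair_index_eq_prod_encode prod_encode_eq)

lemma triangle_mono: "a \<le> b \<Longrightarrow> triangle a \<le> triangle b"
  by (induction b rule: dec_induct) auto

lemma pair_index_less_triangle:
  assumes "a < b" "b \<le> k"
  shows "pair_index a b < triangle k"
proof -
  have "pair_index a b < triangle (Suc (b - 1))"
    unfolding pair_index_def triangle_Suc using assms by linarith
  also have "\<dots> \<le> triangle k"
    using assms by (intro triangle_mono) simp
  finally show ?thesis .
qed

lemma pair_index_surj:
  assumes "t < triangle k"
  obtains a b where "a < b" "b \<le> k" "pair_index a b = t"
proof -
  obtain a c where ac: "prod_decode t = (a, c)"
    by fastforce
  then have t: "t = prod_encode (a, c)"
    by (metis prod_decode_inverse)
  have "a + c < k"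
  proof (rule ccontr)
    assume "\<not> a + c < k"
    then have "triangle k \<le> triangle (a + c)"
      by (intro triangle_mono) simp
    with assms show False
      by (simp add: t prod_encode_def)
  qed
  then show ?thesis
    using that[of a "a + c + 1"] by (simp add: t pair_index_def prod_encode_def)
qed

text \<open>In the symmetric matrix of pair indices every column is increasing off the diagonal; this is what
  orders the sums of the inner vertices.\<close>

lemma pair_index_strict_mono:
  assumes "a < a'" "c \<noteq> a" "c \<noteq> a'"
  shows "pair_index (min a c) (max a c) < pair_index (min a' c) (max a' c)"
proof -
  consider "c < a" | "a < c" "c < a'" | "a' < c"
    using assms by linarith
  then show ?thesis
  proof cases
    case 1
    have "pair_index c a < triangle (a' - 1)"
      using 1 assms by (intro pair_index_less_triangle) auto
    with 1 assms show ?thesis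
      by (simp add: min_def max_def) (simp add: pair_index_def)
  next
    case 2
    have "pair_index a c < triangle (a' - 1)"
      using 2 assms by (intro pair_index_less_triangle) auto
    with 2 assms show ?thesis
      by (simp add: min_def max_def) (simp add: pair_index_def)
  next
    case 3
    with assms show ?thesis
      by (simp add: min_def max_def pair_index_def)
  qed
qed

lemma mult_add_less_mult_add:
  fixes m :: nat
  assumes "t < t'" "r < m"
  shows "m * t + r < m * t' + r'"
proof -
  have "m * t + r < m * Suc t"
    using assms by simp
  also have "\<dots> \<le> m * t'"
    using assms by (intro mult_le_mono2) simp
  finally show ?thesis
    by simp
qed

lemma mult_add_inject:
  fixes m :: nat
  assumes "m * t + r = m * t' + r'" "r < m" "r' < m"
  shows "t = t' \<and> r = r'"
  using assms mult_add_less_mult_add[of t t' r m r'] mult_add_less_mult_add[of t' t r' m r]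
  by (cases t t' rule: linorder_cases) auto

locale labelled_book =
  fixes front :: bool and m k :: nat
  assumes m: "2 \<le> m" and k: "1 \<le> k"
begin

text \<open>The position of the \<open>t\<close>-th pair in the sequence of blocks. The option \<open>front\<close> moves the pair
  \<open>(0, k)\<close>, whose index is \<open>triangle (k - 1)\<close>, to the front, so that the label \<open>0\<close> falls on an edge at a
  hub instead of the edge \<open>(0, 1)\<close>.\<close>

definition block :: "nat \<Rightarrow> nat" where
  "block t = (if front \<and> t \<le> triangle (k - 1) then if t = triangle (k - 1) then 0 else Suc t else t)"

text \<open>The step by which the labels at hub \<open>k + 1\<close> descend from page to page. As it divides \<open>k\<close>, the
  positions \<open>a < k\<close> split into groups of this size, and each group shares \<open>stride * m\<close> consecutive
  labels in an interleaved way.\<close>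

definition stride :: nat where
  "stride = (if even k then 2 else 1)"

definition rising :: "nat \<Rightarrow> nat \<Rightarrow> bool" where
  "rising a b \<longleftrightarrow> odd (a + b) \<or> even k \<and> b = k"

text \<open>To be used for \<open>a < b\<close> only, hence the use of \<open>min\<close> and \<open>max\<close> in \<open>pair_label\<close>. The three cases are the blocks, the edges from inner vertices to hub \<open>k + 1\<close>, and the edge between the hubs.\<close>

definition label :: "nat \<Rightarrow> nat \<Rightarrow> nat \<Rightarrow> nat" where
  "label i a b =
    (if b \<le> k then m * block (pair_index a b) + (if rising a b then i else m - 1 - i)
     else if a < k then m * triangle k + (stride * m * (a div stride) + (a mod stride + stride * (m - 1 - i)))
     else m * (triangle k + k))"

text \<open>The page of an edge is the maximal first component of its ends, since hubs are put on page \<open>0\<close>.\<close>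

definition edge_label :: "(nat \<times> nat) set \<Rightarrow> nat" where
  "edge_label e = label (Max (fst ` e)) (Min (snd ` e)) (Max (snd ` e))"

abbreviation book :: "(nat \<times> nat) graph" where
  "book \<equiv> clique_book m k"

abbreviation pair_label :: "nat \<Rightarrow> nat \<Rightarrow> nat \<Rightarrow> nat" where
  "pair_label i a b \<equiv> label i (min a b) (max a b)"

abbreviation top_label :: nat where
  "top_label \<equiv> m * (triangle k + k)"

lemma stride: "stride > 0" "stride dvd k"
  by (auto simp: stride_def)

lemma edge_label_pair:
  assumes "a \<noteq> b" "a < k + 2" "b < k + 2"
  shows "edge_label {page_vertex k i a, page_vertex k i b} = pair_label i a b"
  using assms by (auto simp: edge_label_def page_vertex_def label_def min_def max_def)

lemma triangle_pred: "triangle k = triangle (k - 1) + k"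
  using k by (cases k) auto

lemma block_less: "t < triangle k \<Longrightarrow> block t < triangle k"
  using triangle_pred k by (auto simp: block_def)

lemma block_strict_mono: "t < t' \<Longrightarrow> t' \<noteq> triangle (k - 1) \<Longrightarrow> block t < block t'"
  by (auto simp: block_def)

lemma block_inject: "block t = block t' \<Longrightarrow> t = t'"
  by (auto simp: block_def split: if_splits)

lemma block_image: "block ` {..<triangle k} = {..<triangle k}"
proof (rule card_subset_eq)
  have "inj_on block {..<triangle k}"
    by (auto simp: inj_on_def dest: block_inject)
  then show "card (block ` {..<triangle k}) = card {..<triangle k}"
    by (rule card_image)
qed (auto simp: block_less)

lemma label_le_k:
  assumes "a < b" "b \<le> k" "i < m"
  shows "label i a b < m * triangle k"
proof -
  have "block (pair_index a b) < triangle k"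
    using assms pair_index_less_triangle by (intro block_less) auto
  from mult_add_less_mult_add[OF this, of _ m 0] show ?thesis
    using assms m by (simp add: label_def)
qed

lemma offset_less:
  assumes "i < m"
  shows "a mod stride + stride * (m - 1 - i) < stride * m"
proof -
  have "a mod stride + stride * (m - 1 - i) < stride + stride * (m - 1 - i)"
    using stride by simp
  also have "\<dots> = stride * Suc (m - 1 - i)"
    by simp
  also have "\<dots> \<le> stride * m"
    using assms by (intro mult_le_mono2) simp
  finally show ?thesis
    by simp
qed

lemma label_hub_bounds:
  assumes "a < k" "i < m"
  shows "m * triangle k \<le> label i a (Suc k)" "label i a (Suc k) < top_label"
proof -
  obtain r where r: "k = stride * r"
    using stride(2) by (elim dvdE)
  have "a div stride < r"
    using assms(1) stride r by (metis less_mult_imp_div_less mult.commute)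
  then have "(stride * m) * (a div stride) + (a mod stride + stride * (m - 1 - i)) < (stride * m) * r + 0"
    by (rule mult_add_less_mult_add) (rule offset_less[OF assms(2)])
  moreover have "top_label = m * triangle k + (stride * m) * r"
    by (subst (2) r) (simp add: distrib_left)
  ultimately show "label i a (Suc k) < top_label" "m * triangle k \<le> label i a (Suc k)"
    using assms(1) by (simp_all only: label_def) auto
qed

lemma label_top: "label i k (Suc k) = top_label"
  by (simp add: label_def)

text \<open>The labels of the three kinds of edges occupy three consecutive intervals.\<close>

lemma label_less_iff:
  assumes "a < b" "b < k + 2" "i < m"
  shows "label i a b < m * triangle k \<longleftrightarrow> b \<le> k" "label i a b < top_label \<longleftrightarrow> a < k"
proof -
  have less: "m * triangle k < top_label"
    using m k by simp
  consider "b \<le> k" | "b = Suc k" "a < k" | "b = Suc k" "a = k"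
    using assms by linarith
  then have "(label i a b < m * triangle k \<longleftrightarrow> b \<le> k) \<and> (label i a b < top_label \<longleftrightarrow> a < k)"
  proof cases
    case 1
    then show ?thesis
      using label_le_k[of a b i] assms less by linarith
  next
    case 2
    then show ?thesis
      using label_hub_bounds[of a i] assms by simp
  next
    case 3
    then show ?thesis
      using less by (simp add: label_top)
  qed
  then show "label i a b < m * triangle k \<longleftrightarrow> b \<le> k" "label i a b < top_label \<longleftrightarrow> a < k"
    by blast+
qed

lemma label_inject:
  assumes ab: "a < b" "b < k + 2" "i < m" and ab': "a' < b'" "b' < k + 2" "i' < m"
    and eq: "label i a b = label i' a' b'"
  shows "a = a' \<and> b = b' \<and> (i = i' \<or> a = k)"
proof -
  have "b \<le> k \<longleftrightarrow> b' \<le> k" "a < k \<longleftrightarrow> a' < k"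
    using label_less_iff[OF ab] label_less_iff[OF ab'] eq by simp_all
  then consider "b \<le> k" "b' \<le> k" | "b = Suc k" "a < k" "b' = Suc k" "a' < k"
    | "b = Suc k" "a = k" "b' = Suc k" "a' = k"
    using ab ab' by linarith
  then show ?thesis
  proof cases
    case 1
    let ?r = "\<lambda>i a b. if rising a b then i else m - 1 - i"
    have "m * block (pair_index a b) + ?r i a b = m * block (pair_index a' b') + ?r i' a' b'"
      using eq 1 by (simp add: label_def)
    then have *: "block (pair_index a b) = block (pair_index a' b') \<and> ?r i a b = ?r i' a' b'"
      by (rule mult_add_inject) (use ab ab' in auto)
    then have "a = a' \<and> b = b'"
      using ab ab' block_inject pair_index_inject by blast
    with * ab ab' show ?thesis
      by (auto split: if_splits)
  next
    case 2
    let ?o = "\<lambda>i a. a mod stride + stride * (m - 1 - i)"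
    have "(stride * m) * (a div stride) + ?o i a = (stride * m) * (a' div stride) + ?o i' a'"
      using eq 2 by (simp add: label_def)
    then have *: "a div stride = a' div stride \<and> ?o i a = ?o i' a'"
      by (rule mult_add_inject) (use offset_less ab ab' in auto)
    have "stride * (m - 1 - i) + a mod stride = stride * (m - 1 - i') + a' mod stride"
      using * by simp
    then have "m - 1 - i = m - 1 - i' \<and> a mod stride = a' mod stride"
      by (rule mult_add_inject) (use stride in auto)
    with * 2 ab ab' show ?thesis
      by (metis div_mult_mod_eq diff_diff_cancel Suc_pred' less_Suc_eq_le m diff_Suc_1 less_le_trans pos2)
  qed (use ab ab' in auto)
qed

lemma edgeE:
  assumes "e \<in> edges book"
  obtains i a b where "i < m" "a < b" "b < k + 2" "e = {page_vertex k i a, page_vertex k i b}"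
    "edge_label e = label i a b"
proof -
  obtain i a b where *: "i < m" "a < b" "b < k + 2" "e = {page_vertex k i a, page_vertex k i b}"
    using assms by (auto simp: clique_book_def)
  then have "edge_label e = label i a b"
    using edge_label_pair[of a b i] by simp
  with * that show ?thesis
    by blast
qed

lemma label_in_image:
  assumes "i < m" "a < b" "b < k + 2"
  shows "label i a b \<in> edge_label ` edges book"
  using assms edge_label_pair[of a b i] edge_clique_book[of i m a k b]
  by (intro image_eqI[of _ _ "{page_vertex k i a, page_vertex k i b}"]) auto

lemma inj_edge_label: "inj_on edge_label (edges book)"
proof (rule inj_onI)
  fix e e' assume "e \<in> edges book" and "e' \<in> edges book" and eq: "edge_label e = edge_label e'"
  obtain i a b where e: "i < m" "a < b" "b < k + 2" "e = {page_vertex k i a, page_vertex k i b}"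
    "edge_label e = label i a b"
    using \<open>e \<in> edges book\<close> by (rule edgeE)
  obtain i' a' b' where e': "i' < m" "a' < b'" "b' < k + 2"
    "e' = {page_vertex k i' a', page_vertex k i' b'}" "edge_label e' = label i' a' b'"
    using \<open>e' \<in> edges book\<close> by (rule edgeE)
  have "a = a' \<and> b = b' \<and> (i = i' \<or> a = k)"
    using e e' eq by (intro label_inject) auto
  then show "e = e'"
    using e e' by (auto simp: page_vertex_def)
qed

lemma image_edge_label: "edge_label ` edges book = {..<Suc top_label}"
proof
  show "edge_label ` edges book \<subseteq> {..<Suc top_label}"
  proof
    fix l assume "l \<in> edge_label ` edges book"
    then obtain e where e: "e \<in> edges book" "l = edge_label e"
      by blast
    then obtain i a b where ab: "a < b" "b < k + 2" "i < m" "l = label i a b"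
      by (metis edgeE)
    show "l \<in> {..<Suc top_label}"
    proof (cases "a < k")
      case True
      then show ?thesis
        using label_less_iff(2)[OF ab(1-3)] ab(4) by simp
    next
      case False
      then have "a = k" "b = Suc k"
        using ab by auto
      then show ?thesis
        using ab(4) by (simp add: label_top)
    qed
  qed
next
  show "{..<Suc top_label} \<subseteq> edge_label ` edges book"
  proof
    fix l assume "l \<in> {..<Suc top_label}"
    then consider "l < m * triangle k" | "m * triangle k \<le> l" "l < top_label" | "l = top_label"
      by fastforce
    then show "l \<in> edge_label ` edges book"
    proof cases
      case 1
      then have "l div m \<in> block ` {..<triangle k}"
        unfolding block_image by (simp add: less_mult_imp_div_less mult.commute)
      then obtain t where t: "t < triangle k" "l div m = block t"
        by auto
      then obtain a b where ab: "a < b" "b \<le> k" "pair_index a b = t"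
        using pair_index_surj by blast
      define i where "i = (if rising a b then l mod m else m - 1 - l mod m)"
      have "l mod m < m"
        using m by simp
      then have "(if rising a b then i else m - 1 - i) = l mod m" "i < m"
        by (auto simp: i_def)
      moreover have "l = m * (l div m) + l mod m"
        by simp
      ultimately have "label i a b = l"
        using ab t by (simp add: label_def)
      then show ?thesis
        using label_in_image[of i a b] ab \<open>i < m\<close> by simp
    next
      case 2
      \<comment> \<open>By counting: \<open>m * k\<close> distinct labels in an interval of that length.\<close>
      let ?f = "\<lambda>(i, a). label i a (Suc k)"
      have "inj_on ?f ({..<m} \<times> {..<k})"
        by (auto simp: inj_on_def dest!: label_inject[rotated -1])
      then have "card (?f ` ({..<m} \<times> {..<k})) = card {m * triangle k..<top_label}"
        by (simp add: card_image algebra_simps)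
      then have "?f ` ({..<m} \<times> {..<k}) = {m * triangle k..<top_label}"
        using label_hub_bounds by (intro card_subset_eq) auto
      then have "l \<in> ?f ` ({..<m} \<times> {..<k})"
        using 2 by simp
      then show ?thesis
        using label_in_image by fastforce
    next
      case 3
      then show ?thesis
        using label_in_image[of 0 k "Suc k"] m by (simp add: label_top)
    qed
  qed
qed

lemma card_edges: "card (edges book) = Suc top_label"
  using card_image[OF inj_edge_label] by (simp add: image_edge_label)

lemma bij_edge_label: "bij_betw edge_label (edges book) {..<card (edges book)}"
  using inj_edge_label by (simp add: bij_betw_def image_edge_label card_edges)

end

section \<open>The vertex sums of the labeling\<close>

lemma sum_alternating:
  fixes K v :: nat
  assumes "even K"
  shows "(\<Sum>b<K. if odd (v + b) then 1 else - 1 :: int) = 0"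
proof -
  have "(\<Sum>b<2 * j. if odd (v + b) then 1 else - 1 :: int) = 0" for j
    by (induct j) auto
  with assms show ?thesis
    by (elim evenE) simp
qed

text \<open>The term for \<open>b = v\<close> would be \<open>- 1\<close>, and with it the sum is alternating of even length.\<close>

lemma sum_alternating_remove:
  fixes K v :: nat
  assumes "even K" "v < K"
  shows "(\<Sum>b\<in>{..<K} - {v}. if odd (v + b) then 1 else - 1 :: int) = 1"
  using sum_alternating[OF assms(1), of v] sum.remove[of "{..<K}" v "\<lambda>b. if odd (v + b) then 1 else - 1 :: int"]
    assms(2) by simp

context labelled_book
begin

text \<open>The change of the label of the edge from \<open>v\<close> to \<open>b\<close> from one page to the next.\<close>

definition slope :: "nat \<Rightarrow> nat \<Rightarrow> int" where
  "slope v b = (if b = Suc k then - int stride else if rising (min v b) (max v b) then 1 else - 1)"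

lemma label_linear:
  assumes "v < k" "b < k + 2" "b \<noteq> v" "i < m"
  shows "int (pair_label i v b) = int (pair_label 0 v b) + slope v b * int i"
proof (cases "b = Suc k")
  case True
  have "int (stride * (m - 1 - i)) = int (stride * (m - 1)) - int stride * int i"
    using assms by (simp add: right_diff_distrib distrib_left)
  with True assms show ?thesis
    by (simp add: label_def slope_def min_def max_def)
next
  case False
  then have "max v b \<le> k"
    using assms by simp
  with False assms m show ?thesis
    by (auto simp: label_def slope_def of_nat_diff)
qed

text \<open>The hub \<open>k + 1\<close> contributes \<open>-2\<close> or \<open>-1\<close>. For even \<open>k\<close> the inner vertices together
  contribute \<open>1\<close> and so does the hub \<open>k\<close>; for odd \<open>k\<close> the hub \<open>k\<close> continues the alternating pattern of the inner vertices to even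
  length, and together they contribute \<open>1\<close>.\<close>

lemma sum_slope:
  assumes "v < k"
  shows "(\<Sum>b\<in>{..<k + 2} - {v}. slope v b) = 0"
proof -
  have min_max: "min v b + max v b = v + b" for b
    by (simp add: min_def max_def)
  show ?thesis
  proof (cases "even k")
    case True
    have "{..<k + 2} - {v} = insert (Suc k) (insert k ({..<k} - {v}))"
      using assms by auto
    then have "(\<Sum>b\<in>{..<k + 2} - {v}. slope v b) = slope v (Suc k) + slope v k + (\<Sum>b\<in>{..<k} - {v}. slope v b)"
      by simp
    also have "(\<Sum>b\<in>{..<k} - {v}. slope v b) = (\<Sum>b\<in>{..<k} - {v}. if odd (v + b) then 1 else - 1)"
      using assms by (intro sum.cong) (auto simp: slope_def rising_def min_max max_def split: if_splits)
    also have "\<dots> = 1"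
      using True assms by (rule sum_alternating_remove)
    finally show ?thesis
      using True assms by (simp add: slope_def stride_def rising_def)
  next
    case False
    have "{..<k + 2} - {v} = insert (Suc k) ({..<Suc k} - {v})"
      using assms by auto
    then have "(\<Sum>b\<in>{..<k + 2} - {v}. slope v b) = slope v (Suc k) + (\<Sum>b\<in>{..<Suc k} - {v}. slope v b)"
      by simp
    also have "(\<Sum>b\<in>{..<Suc k} - {v}. slope v b) = (\<Sum>b\<in>{..<Suc k} - {v}. if odd (v + b) then 1 else - 1)"
      using assms False by (intro sum.cong) (auto simp: slope_def rising_def min_max)
    also have "\<dots> = 1"
      using False assms by (intro sum_alternating_remove) auto
    finally show ?thesis
      using False assms by (simp add: slope_def stride_def)
  qed
qed

lemma inner_sum_const:
  assumes "v < k" "i < m"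
  shows "(\<Sum>b\<in>{..<k + 2} - {v}. pair_label i v b) = (\<Sum>b\<in>{..<k + 2} - {v}. pair_label 0 v b)"
proof -
  have "int (\<Sum>b\<in>{..<k + 2} - {v}. pair_label i v b)
      = (\<Sum>b\<in>{..<k + 2} - {v}. int (pair_label 0 v b) + slope v b * int i)"
    unfolding of_nat_sum using assms by (intro sum.cong refl label_linear) auto
  also have "\<dots> = int (\<Sum>b\<in>{..<k + 2} - {v}. pair_label 0 v b)"
    using sum_slope[OF assms(1)] by (simp only: sum.distrib flip: sum_distrib_right) simp
  finally show ?thesis
    by (simp only: of_nat_eq_iff)
qed

text \<open>The common sum of the vertices at position \<open>a\<close>, which by \<open>inner_sum_const\<close> may be read off from
  page \<open>0\<close> for inner positions.\<close>

definition colour :: "nat \<Rightarrow> nat" where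
  "colour a = (if a < k then \<Sum>b\<in>{..<k + 2} - {a}. pair_label 0 a b
     else (\<Sum>i<m. \<Sum>b<k. label i b a) + top_label)"

lemma vertex_sum_edge_label:
  assumes "i < m" "a < k + 2"
  shows "vertex_sum book edge_label (page_vertex k i a) = colour a"
proof (cases "a < k")
  case True
  have "vertex_sum book edge_label (page_vertex k i a)
      = (\<Sum>b\<in>{..<k + 2} - {a}. edge_label {page_vertex k i a, page_vertex k i b})"
    unfolding vertex_sum_def neighbours_inner[OF assms(1) True]
    by (subst sum.reindex) (auto simp: inj_on_def page_vertex_eq_iff)
  also have "\<dots> = (\<Sum>b\<in>{..<k + 2} - {a}. pair_label i a b)"
    using assms by (intro sum.cong refl edge_label_pair) auto
  also have "\<dots> = colour a"
    using inner_sum_const[OF True assms(1)] True by (simp add: colour_def)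
  finally show ?thesis .
next
  case False
  define c where "c = (if a = k then Suc k else k)"
  have a: "a = k \<and> c = Suc k \<or> a = Suc k \<and> c = k"
    using False assms by (auto simp: c_def)
  have "edge_label {page_vertex k i a, (0, c)} = top_label"
    using a edge_label_pair[of a c i] by (auto simp: page_vertex_def label_top)
  moreover have "(\<Sum>(j, b)\<in>{..<m} \<times> {..<k}. edge_label {page_vertex k i a, (j, b)})
      = (\<Sum>(j, b)\<in>{..<m} \<times> {..<k}. label j b a)"
  proof (intro sum.cong refl, clarify)
    fix j b assume "b < k"
    have "edge_label {page_vertex k j a, page_vertex k j b} = pair_label j a b"
      using \<open>b < k\<close> a by (intro edge_label_pair) auto
    moreover have "page_vertex k j a = page_vertex k i a" "page_vertex k j b = (j, b)"
      using \<open>b < k\<close> a by (auto simp: page_vertex_def)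
    ultimately show "edge_label {page_vertex k i a, (j, b)} = label j b a"
      using \<open>b < k\<close> a by (auto simp: min_def max_def)
  qed
  moreover have "vertex_sum book edge_label (page_vertex k i a)
      = edge_label {page_vertex k i a, (0, c)}
        + (\<Sum>(j, b)\<in>{..<m} \<times> {..<k}. edge_label {page_vertex k i a, (j, b)})"
    unfolding vertex_sum_def neighbours_hub[of m a k c i, OF _ a]
    using a m by (subst neighbours_hub[of m a k c i, OF _ a]) (auto simp: case_prod_unfold)
  ultimately show ?thesis
    using False by (simp add: colour_def sum.cartesian_product)
qed

definition valency :: "nat \<Rightarrow> nat" where
  "valency a = (if a < k then k + 1 else m * k + 1)"

lemma card_neighbours:
  assumes "i < m" "a < k + 2"
  shows "card {z. {page_vertex k i a, z} \<in> edges book} = valency a"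
proof (cases "a < k")
  case True
  have "inj_on (page_vertex k i) ({..<k + 2} - {a})"
    by (auto simp: inj_on_def page_vertex_eq_iff)
  then show ?thesis
    using True assms by (simp add: neighbours_inner card_image valency_def)
next
  case False
  define c where "c = (if a = k then Suc k else k)"
  have a: "a = k \<and> c = Suc k \<or> a = Suc k \<and> c = k"
    using False assms by (auto simp: c_def)
  have "card (insert (0, c) ({..<m} \<times> {..<k})) = Suc (m * k)"
    using a by (subst card_insert_disjoint) auto
  then show ?thesis
    using False m neighbours_hub[of m a k c i, OF _ a] by (simp add: valency_def)
qed

text \<open>For \<open>c \<le> k\<close> the two labels lie in different blocks. The block at the front is no exception: as
  \<open>a' < k\<close> is not the smallest position, \<open>(0, k)\<close> can only be the pair of \<open>a\<close> and \<open>c\<close>.\<close>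

lemma pair_label_strict_mono:
  assumes "i < m" "a < a'" "a' < k" "c < k + 2" "c \<noteq> a" "c \<noteq> a'"
  shows "pair_label i a c < pair_label i a' c"
proof (cases "c = Suc k")
  case True
  have "stride * m * (a div stride) + (a mod stride + stride * (m - 1 - i))
      < stride * m * (a' div stride) + (a' mod stride + stride * (m - 1 - i))"
  proof (cases "a div stride = a' div stride")
    case True
    then have "a mod stride < a' mod stride"
      using \<open>a < a'\<close> by (metis add_less_cancel_left mult_div_mod_eq)
    with True show ?thesis
      by simp
  next
    case False
    then have "a div stride < a' div stride"
      using \<open>a < a'\<close> by (simp add: div_le_mono le_neq_implies_less)
    then show ?thesis
      by (rule mult_add_less_mult_add) (rule offset_less[OF assms(1)])
  qed
  with True assms show ?thesis
    by (simp add: label_def min_def max_def)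
next
  case False
  have "pair_index (min a' c) (max a' c) \<noteq> triangle (k - 1)"
  proof
    assume "pair_index (min a' c) (max a' c) = triangle (k - 1)"
    then have "pair_index (min a' c) (max a' c) = pair_index 0 k"
      by (simp add: pair_index_def)
    then have "min a' c = 0 \<and> max a' c = k"
      using assms by (intro pair_index_inject) auto
    then show False
      using assms by (auto simp: min_def max_def split: if_splits)
  qed
  then have "block (pair_index (min a c) (max a c)) < block (pair_index (min a' c) (max a' c))"
    using assms by (intro block_strict_mono pair_index_strict_mono)
  then have "m * block (pair_index (min a c) (max a c)) + r
      < m * block (pair_index (min a' c) (max a' c)) + r'" if "r < m" for r r'
    using that by (rule mult_add_less_mult_add)
  moreover have "max a c \<le> k" "max a' c \<le> k"
    using assms False by auto
  ultimately show ?thesis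
    using assms by (simp add: label_def)
qed

text \<open>The pair \<open>(0, k)\<close> must be excluded on the right, since its block may be at the front.\<close>

lemma label_less_hub_label:
  assumes "a < b" "b < k" "0 < c" "c < k" "i < m"
  shows "label i a b < label j c k"
proof -
  have "pair_index a b < triangle (k - 1)"
    using assms by (intro pair_index_less_triangle) auto
  then have "block (pair_index a b) < block (pair_index c k)"
    using assms by (intro block_strict_mono) (auto simp: pair_index_def)
  then have "m * block (pair_index a b) + r < m * block (pair_index c k) + r'" if "r < m" for r r'
    using that by (rule mult_add_less_mult_add)
  then show ?thesis
    using assms by (simp add: label_def)
qed

text \<open>Compare the edges at \<open>v\<close> on page \<open>0\<close> with some of the edges at hub \<open>k\<close>: the edge to an inner vertex
  \<open>b\<close> with the edge from \<open>b\<close> to the hub, the edge to hub \<open>k + 1\<close> with the edge between the hubs, and the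
  edge to hub \<open>k\<close> with itself. Only \<open>b = 0\<close> may fail, as the edges from \<open>0\<close> to the hub may carry the
  smallest labels; there the edge from \<open>v\<close> to the hub on page \<open>1\<close> takes its place.\<close>

lemma colour_inner_less_hub:
  assumes "v < k"
  shows "colour v < colour k"
proof -
  let ?A = "{..<k} - {v}"
  have inner: "pair_label 0 v b < label 0 b k" if "b < k" "b \<noteq> v" "b \<noteq> 0" for b
    using that assms m label_less_hub_label[of "min v b" "max v b" b 0 0] by auto
  have "(\<Sum>b\<in>?A. pair_label 0 v b) \<le> (\<Sum>b\<in>?A. label 0 b k) + label 1 v k"
  proof (cases "v = 0")
    case True
    then have "(\<Sum>b\<in>?A. pair_label 0 v b) \<le> (\<Sum>b\<in>?A. label 0 b k)"
      using inner by (intro sum_mono) (auto intro!: less_imp_le)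
    then show ?thesis
      by simp
  next
    case False
    define B where "B = {..<k} - {0, v}"
    have A: "?A = insert 0 B" and B: "finite B" "0 \<notin> B"
      using assms False by (auto simp: B_def)
    have "(\<Sum>b\<in>?A. pair_label 0 v b) = pair_label 0 v 0 + (\<Sum>b\<in>B. pair_label 0 v b)"
      unfolding A using B by simp
    also have "pair_label 0 v 0 \<le> label 1 v k"
      using label_less_hub_label[of 0 v v 0 1] assms False m by simp
    also have "(\<Sum>b\<in>B. pair_label 0 v b) \<le> (\<Sum>b\<in>B. label 0 b k)"
      using inner by (intro sum_mono) (auto simp: B_def intro!: less_imp_le)
    also have "(\<Sum>b\<in>B. label 0 b k) \<le> (\<Sum>b\<in>?A. label 0 b k)"
      by (intro sum_mono2) (auto simp: B_def)
    finally show ?thesis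
      by simp
  qed
  moreover have "{..<k + 2} - {v} = insert (Suc k) (insert k ?A)"
    using assms by auto
  then have "colour v = label 0 v (Suc k) + label 0 v k + (\<Sum>b\<in>?A. pair_label 0 v b)"
    using assms by (simp add: colour_def)
  moreover have "(\<Sum>b<k. label 0 b k) = label 0 v k + (\<Sum>b\<in>?A. label 0 b k)"
    using assms by (simp add: sum.remove)
  moreover have "label 1 v k \<le> (\<Sum>b<k. label 1 b k)"
    using assms by (intro member_le_sum) auto
  moreover have "(\<Sum>i\<in>{0, 1}. \<Sum>b<k. label i b k) \<le> (\<Sum>i<m. \<Sum>b<k. label i b k)"
    using m by (intro sum_mono2) auto
  moreover have "label 0 v (Suc k) < top_label"
    using label_hub_bounds[of v 0] assms m by simp
  ultimately show ?thesis
    by (simp add: colour_def)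
qed

lemma colour_strict_mono:
  assumes "a < a'" "a' < k + 2"
  shows "colour a < colour a'"
proof -
  have hubs: "colour k < colour (Suc k)"
  proof -
    have "label i b k < label i b (Suc k)" if "i < m" "b < k" for i b
      using that label_le_k[of b k i] label_hub_bounds[of b i] by simp
    then have "(\<Sum>i<m. \<Sum>b<k. label i b k) < (\<Sum>i<m. \<Sum>b<k. label i b (Suc k))"
      using m k by (intro sum_strict_mono) (auto simp: lessThan_empty_iff)
    then show ?thesis
      by (simp add: colour_def)
  qed
  consider "a' < k" | "a < k" "a' = k" | "a < k" "a' = Suc k" | "a = k" "a' = Suc k"
    using assms by linarith
  then show ?thesis
  proof cases
    case 1
    define A where "A = {..<k + 2} - {a, a'}"
    have A: "{..<k + 2} - {a} = insert a' A" "{..<k + 2} - {a'} = insert a A"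
      "finite A" "a \<notin> A" "a' \<notin> A"
      using assms by (auto simp: A_def)
    have "colour a = pair_label 0 a a' + (\<Sum>c\<in>A. pair_label 0 a c)"
      using 1 assms A(3,5) unfolding colour_def A(1) by simp
    also have "\<dots> < pair_label 0 a a' + (\<Sum>c\<in>A. pair_label 0 a' c)"
    proof (intro add_strict_left_mono sum_strict_mono)
      show "A \<noteq> {}"
        using 1 assms by (auto simp: A_def)
      show "pair_label 0 a c < pair_label 0 a' c" if "c \<in> A" for c
        using that 1 assms m by (intro pair_label_strict_mono) (auto simp: A_def)
    qed (rule A(3))
    also have "pair_label 0 a a' = pair_label 0 a' a"
      by (simp only: min.commute max.commute)
    also have "pair_label 0 a' a + (\<Sum>c\<in>A. pair_label 0 a' c) = colour a'"
      using 1 assms A(3,4) unfolding colour_def A(2) by simp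
    finally show ?thesis .
  qed (use colour_inner_less_hub[of a] hubs in auto)
qed

lemma inj_on_colour: "inj_on colour {..<k + 2}"
  by (rule linorder_inj_onI) (auto dest: colour_strict_mono)

text \<open>Raising all labels by one adds \<open>valency a\<close> to the sum at position \<open>a\<close>; the valencies increase
  weakly with \<open>a\<close>.\<close>

lemma chi_la_book: "chi_la book = k + 2"
proof (rule chi_la_subgraph_clique_book[OF refl subset_refl])
  have "bij_betw Suc {..<card (edges book)} {1..card (edges book)}"
    by (auto simp: bij_betw_def image_Suc_lessThan)
  from bij_betw_trans[OF bij_edge_label this]
  show "bij_betw (\<lambda>e. Suc (edge_label e)) (edges book) {1..card (edges book)}"
    by (simp add: comp_def)
  show "vertex_sum book (\<lambda>e. Suc (edge_label e)) (page_vertex k i a) = colour a + valency a"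
    if "i < m" "a < k + 2" for i a
    using that by (simp only: vertex_sum_Suc vertex_sum_edge_label card_neighbours)
  show "inj_on (\<lambda>a. colour a + valency a) {..<k + 2}"
  proof (rule linorder_inj_onI)
    fix a a' :: nat assume *: "a < a'" "a \<in> {..<k + 2}" "a' \<in> {..<k + 2}"
    have "k \<le> m * k"
      using m by simp
    then have "valency a \<le> valency a'"
      using * by (simp add: valency_def)
    moreover have "colour a < colour a'"
      using * by (intro colour_strict_mono) auto
    ultimately show "colour a + valency a \<noteq> colour a' + valency a'"
      by linarith
  qed auto
  show "0 < m"
    using m by simp
  then show "{page_vertex k 0 a, page_vertex k 0 b} \<in> edges book" if "a < b" "b < k + 2" for a b
    using that by (intro edge_clique_book) auto
qed

text \<open>The deleted edge lies on page \<open>0\<close> and is not shared as \<open>a < k\<close>, so page \<open>1\<close> stays complete.\<close>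

lemma chi_la_delete_edge_book:
  assumes ab: "a < b" "b < k + 2" "a < k" and zero: "label 0 a b = 0"
  shows "chi_la (delete_edge book {page_vertex k 0 a, page_vertex k 0 b}) = k + 2"
    (is "chi_la (delete_edge book ?e) = _")
proof (rule chi_la_subgraph_clique_book)
  have e: "?e \<in> edges book"
    using ab m by (intro edge_clique_book) auto
  have e0: "edge_label ?e = 0"
    using ab zero edge_label_pair[of a b 0] by simp
  show "verts (delete_edge book ?e) = verts book" "edges (delete_edge book ?e) \<subseteq> edges book"
    by (auto simp: delete_edge_def)
  show "bij_betw edge_label (edges (delete_edge book ?e)) {1..card (edges (delete_edge book ?e))}"
    using bij_betw_delete_zero[OF bij_edge_label e e0] by (simp add: delete_edge_def)
  show "vertex_sum (delete_edge book ?e) edge_label (page_vertex k i x) = colour x"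
    if "i < m" "x < k + 2" for i x
    using that by (simp only: vertex_sum_delete_zero[where f = edge_label, OF simple_clique_book e0] vertex_sum_edge_label)
  show "inj_on colour {..<k + 2}"
    by (rule inj_on_colour)
  show "1 < m"
    using m by simp
  then show "{page_vertex k 1 x, page_vertex k 1 y} \<in> edges (delete_edge book ?e)"
    if "x < y" "y < k + 2" for x y
    using that ab edge_clique_book[of 1 m x k y]
    by (auto simp: delete_edge_def doubleton_eq_iff page_vertex_eq_iff)
qed

end

lemma chi_la_clique_book:
  assumes "2 \<le> m" "1 \<le> k"
  shows "chi_la (clique_book m k) = k + 2"
proof -
  interpret labelled_book False m k
    using assms by unfold_locales
  show ?thesis
    by (rule chi_la_book)
qed

lemma chi_la_clique_book_delete_inner:
  assumes "2 \<le> m" "2 \<le> k"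
  shows "chi_la (delete_edge (clique_book m k) {page_vertex k 0 0, page_vertex k 0 1}) = k + 2"
proof -
  interpret labelled_book False m k
    using assms by unfold_locales auto
  have "label 0 0 1 = 0"
    using assms by (simp add: label_def block_def rising_def pair_index_def)
  then show ?thesis
    using assms by (intro chi_la_delete_edge_book) auto
qed

lemma chi_la_clique_book_delete_outer:
  assumes "2 \<le> m" "1 \<le> k"
  shows "chi_la (delete_edge (clique_book m k) {page_vertex k 0 0, page_vertex k 0 k}) = k + 2"
proof -
  interpret labelled_book True m k
    using assms by unfold_locales
  have "label 0 0 k = 0"
    using assms by (simp add: label_def block_def rising_def pair_index_def)
  then show ?thesis
    using assms by (intro chi_la_delete_edge_book) auto
qed

section \<open>The join of the amalgamation with a vertex is a book\<close>

definition amalgam_vertex :: "nat \<Rightarrow> nat \<Rightarrow> nat \<times> nat" where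
  "amalgam_vertex i a = (if a = 0 then common_vertex else (i, a))"

lemma verts_amalgamation_eq:
  assumes "1 \<le> m" "1 \<le> n"
  shows "verts (amalgamation m n) = {amalgam_vertex i a | i a. i < m \<and> a < n}"
proof (intro set_eqI iffI)
  fix x assume "x \<in> verts (amalgamation m n)"
  then consider "x = amalgam_vertex 0 0" | i a where "i < m" "a < n" "x = amalgam_vertex i a"
    using assms by (auto simp: verts_amalgamation amalgam_vertex_def)
  then show "x \<in> {amalgam_vertex i a | i a. i < m \<and> a < n}"
    using assms by cases force+
next
  fix x assume "x \<in> {amalgam_vertex i a | i a. i < m \<and> a < n}"
  then obtain i a where "i < m" "a < n" "x = amalgam_vertex i a"
    by blast
  then show "x \<in> verts (amalgamation m n)"
    using assms by (cases "a = 0") (auto simp: verts_amalgamation amalgam_vertex_def)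
qed

lemma edges_amalgamation:
  "edges (amalgamation m n) = {{amalgam_vertex i a, amalgam_vertex i b} | i a b. i < m \<and> a < n \<and> b < n \<and> a \<noteq> b}"
  (is "_ = ?R")
proof
  let ?f = "\<lambda>(i, v). if v = 0 then (0, 0) else (i::nat, v::nat)"
  have f: "?f ` Pair i ` {a, b} = {amalgam_vertex i a, amalgam_vertex i b}" for i a b
    by (simp add: amalgam_vertex_def common_vertex_def)
  have E: "edges (amalgamation m n) = (`) ?f ` edges (copies m (complete_graph n))"
    by (simp add: amalgamation_def one_point_union_def map_graph_def)
  show "edges (amalgamation m n) \<subseteq> ?R"
  proof
    fix e assume "e \<in> edges (amalgamation m n)"
    then obtain d where "d \<in> edges (copies m (complete_graph n))" "e = ?f ` d"
      unfolding E by blast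
    moreover from this obtain i a b where "i < m" "a < n" "b < n" "a \<noteq> b" "d = Pair i ` {a, b}"
      by (auto simp: copies_def complete_graph_def)
    ultimately show "e \<in> ?R"
      using f by blast
  qed
  show "?R \<subseteq> edges (amalgamation m n)"
  proof
    fix e assume "e \<in> ?R"
    then obtain i a b where *: "i < m" "a < n" "b < n" "a \<noteq> b" "e = {amalgam_vertex i a, amalgam_vertex i b}"
      by blast
    then have "{a, b} \<in> edges (complete_graph n)"
      by (auto simp: complete_graph_def)
    then have "Pair i ` {a, b} \<in> edges (copies m (complete_graph n))"
      using * unfolding copies_def by (simp only: graph.simps) blast
    then show "e \<in> edges (amalgamation m n)"
      unfolding E * f[symmetric] by (rule imageI)
  qed
qed

text \<open>Vertex \<open>a\<close> of the \<open>i\<close>-th clique of the join, where \<open>0\<close> stands for the common vertex and \<open>n\<close> for the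
  new one.\<close>

definition join_vertex :: "nat \<Rightarrow> nat \<Rightarrow> nat \<Rightarrow> (nat \<times> nat) option" where
  "join_vertex n i a = (if a < n then Some (amalgam_vertex i a) else None)"

lemma verts_join_amalgamation:
  assumes "1 \<le> m" "1 \<le> n"
  shows "verts (join_K1 (amalgamation m n)) = {join_vertex n i a | i a. i < m \<and> a < Suc n}"
proof (intro set_eqI iffI)
  note V = verts_amalgamation_eq[OF assms]
  fix x assume "x \<in> verts (join_K1 (amalgamation m n))"
  then consider "x = None" | i a where "i < m" "a < n" "x = Some (amalgam_vertex i a)"
    by (auto simp: join_K1_def V)
  then show "x \<in> {join_vertex n i a | i a. i < m \<and> a < Suc n}"
  proof cases
    case 1
    then have "x = join_vertex n 0 n"
      by (simp add: join_vertex_def)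
    moreover have "0 < m" "n < Suc n"
      using assms by simp_all
    ultimately show ?thesis
      by blast
  next
    case (2 i a)
    then have "x = join_vertex n i a"
      by (simp add: join_vertex_def)
    moreover have "a < Suc n"
      using 2 by simp
    ultimately show ?thesis
      using 2(1) by blast
  qed
next
  fix x assume "x \<in> {join_vertex n i a | i a. i < m \<and> a < Suc n}"
  then obtain i a where ia: "i < m" "x = join_vertex n i a"
    by blast
  show "x \<in> verts (join_K1 (amalgamation m n))"
  proof (cases "a < n")
    case True
    then have "amalgam_vertex i a \<in> verts (amalgamation m n)"
      using ia verts_amalgamation_eq[OF assms] by blast
    with True ia show ?thesis
      by (simp add: join_K1_def join_vertex_def)
  qed (simp add: ia join_K1_def join_vertex_def)
qed

lemma edges_join_amalgamation:
  assumes "1 \<le> m" "1 \<le> n"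
  shows "edges (join_K1 (amalgamation m n)) =
    {{join_vertex n i a, join_vertex n i b} | i a b. i < m \<and> a < Suc n \<and> b < Suc n \<and> a \<noteq> b}" (is "_ = ?R")
proof
  note V = verts_amalgamation_eq[OF assms]
  show "edges (join_K1 (amalgamation m n)) \<subseteq> ?R"
  proof
    fix e assume "e \<in> edges (join_K1 (amalgamation m n))"
    then consider i a b where "i < m" "a < n" "b < n" "a \<noteq> b" "e = {Some (amalgam_vertex i a), Some (amalgam_vertex i b)}"
      | i a where "i < m" "a < n" "e = {None, Some (amalgam_vertex i a)}"
      by (auto simp: join_K1_def V edges_amalgamation)
    then show "e \<in> ?R"
    proof cases
      case (1 i a b)
      then have "e = {join_vertex n i a, join_vertex n i b}"
        by (simp add: join_vertex_def)
      moreover have "a < Suc n" "b < Suc n"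
        using 1 by simp_all
      ultimately show ?thesis
        using 1 by blast
    next
      case (2 i a)
      then have "e = {join_vertex n i n, join_vertex n i a}"
        by (simp add: join_vertex_def)
      moreover have "n < Suc n" "a < Suc n" "n \<noteq> a"
        using 2 by simp_all
      ultimately show ?thesis
        using 2 by blast
    qed
  qed
  have hub: "{None, Some (amalgam_vertex i c)} \<in> edges (join_K1 (amalgamation m n))"
    if "i < m" "c < n" for i c
  proof -
    have "amalgam_vertex i c \<in> verts (amalgamation m n)"
      using that V by blast
    then show ?thesis
      unfolding join_K1_def graph.simps by blast
  qed
  show "?R \<subseteq> edges (join_K1 (amalgamation m n))"
  proof
    fix e assume "e \<in> ?R"
    then obtain i a b where e: "i < m" "a < Suc n" "b < Suc n" "a \<noteq> b" "e = {join_vertex n i a, join_vertex n i b}"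
      by blast
    then consider "a < n" "b < n" | "a = n" "b < n" | "a < n" "b = n"
      by linarith
    then show "e \<in> edges (join_K1 (amalgamation m n))"
    proof cases
      case 1
      then have "{amalgam_vertex i a, amalgam_vertex i b} \<in> edges (amalgamation m n)"
        using e by (auto simp: edges_amalgamation)
      then show ?thesis
        using 1 e by (auto simp: join_K1_def join_vertex_def intro!: image_eqI[of _ _ "{amalgam_vertex i a, amalgam_vertex i b}"])
    next
      case 2
      then have "e = {None, Some (amalgam_vertex i b)}"
        using e by (simp add: join_vertex_def)
      then show ?thesis
        using hub[OF e(1) \<open>b < n\<close>] by simp
    next
      case 3
      then have "e = {None, Some (amalgam_vertex i a)}"
        using e by (simp add: join_vertex_def insert_commute)
      then show ?thesis
        using hub[OF e(1) \<open>a < n\<close>] by simp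
    qed
  qed
qed

lemma join_vertex_eq_iff:
  assumes "a < Suc n" "b < Suc n"
  shows "join_vertex n i a = join_vertex n j b \<longleftrightarrow> a = b \<and> (a \<noteq> 0 \<and> a \<noteq> n \<longrightarrow> i = j)"
  using assms by (auto simp: join_vertex_def amalgam_vertex_def common_vertex_def)

text \<open>An isomorphism from the book onto the join for every renumbering \<open>\<rho>\<close> of the pages and \<open>\<tau>\<close> of the
  positions. The freedom in \<open>\<rho>\<close> and \<open>\<tau>\<close> serves to carry the edge labeled \<open>0\<close> to a given edge.\<close>

locale book_embedding =
  fixes m k :: nat and \<rho> \<tau> :: "nat \<Rightarrow> nat"
  assumes m: "2 \<le> m" and k: "1 \<le> k"
    and \<rho>: "bij_betw \<rho> {..<m} {..<m}" and \<tau>: "bij_betw \<tau> {..<k + 2} {..<k + 2}"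
    and hubs: "\<tau> k = 0" "\<tau> (Suc k) = Suc k"
begin

definition embed :: "nat \<times> nat \<Rightarrow> (nat \<times> nat) option" where
  "embed = (\<lambda>(i, a). join_vertex (Suc k) (\<rho> i) (\<tau> a))"

lemma embed_page_vertex:
  assumes "a < k + 2"
  shows "embed (page_vertex k i a) = join_vertex (Suc k) (\<rho> i) (\<tau> a)"
proof -
  consider "a < k" | "a = k" | "a = Suc k"
    using assms by linarith
  then show ?thesis
    by cases (auto simp: embed_def page_vertex_def hubs join_vertex_def amalgam_vertex_def)
qed

lemma rho_less: "i < m \<Longrightarrow> \<rho> i < m"
  using bij_betwE[OF \<rho>] by simp

lemma tau_less: "a < k + 2 \<Longrightarrow> \<tau> a < k + 2"
  using bij_betwE[OF \<tau>] by blast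

lemma tau_eq_iff: "a < k + 2 \<Longrightarrow> b < k + 2 \<Longrightarrow> \<tau> a = \<tau> b \<longleftrightarrow> a = b"
  using \<tau> by (auto simp: bij_betw_def inj_on_def)

lemma rho_surj: "i < m \<Longrightarrow> \<exists>j<m. \<rho> j = i"
  using bij_betw_imp_surj_on[OF \<rho>] by (metis imageE lessThan_iff)

lemma tau_surj: "a < k + 2 \<Longrightarrow> \<exists>b<k + 2. \<tau> b = a"
  using bij_betw_imp_surj_on[OF \<tau>] by (metis imageE lessThan_iff)

lemma inj_on_embed: "inj_on embed (verts (clique_book m k))"
proof (rule inj_onI)
  fix x y assume "x \<in> verts (clique_book m k)" "y \<in> verts (clique_book m k)"
    and eq: "embed x = embed y"
  then obtain i a j b where xy: "x = page_vertex k i a" "y = page_vertex k j b"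
    "i < m" "j < m" "a < k + 2" "b < k + 2"
    by (auto simp: clique_book_def)
  then have *: "\<tau> a = \<tau> b \<and> (\<tau> a \<noteq> 0 \<and> \<tau> a \<noteq> Suc k \<longrightarrow> \<rho> i = \<rho> j)"
    using eq tau_less by (simp add: embed_page_vertex join_vertex_eq_iff)
  moreover have "a = b"
    using * xy tau_eq_iff by blast
  moreover have "\<tau> a \<noteq> 0" "\<tau> a \<noteq> Suc k" if "a < k"
    using that tau_eq_iff[of a k] tau_eq_iff[of a "Suc k"] by (auto simp: hubs)
  moreover have "inj_on \<rho> {..<m}"
    using \<rho> by (rule bij_betw_imp_inj_on)
  ultimately show "x = y"
    using xy by (auto simp: page_vertex_eq_iff inj_on_def)
qed

lemma map_graph_embed: "map_graph embed (clique_book m k) = join_K1 (amalgamation m (Suc k))"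
proof (rule graph.equality)
  have "verts (map_graph embed (clique_book m k))
      = {embed (page_vertex k i a) | i a. i < m \<and> a < k + 2}"
    unfolding map_graph_def clique_book_def graph.simps by blast
  also have "\<dots> = {join_vertex (Suc k) (\<rho> i) (\<tau> a) | i a. i < m \<and> a < k + 2}"
    by (metis (no_types, opaque_lifting) embed_page_vertex)
  also have "\<dots> = {join_vertex (Suc k) i a | i a. i < m \<and> a < k + 2}"
    using rho_less tau_less rho_surj tau_surj by (safe; metis)
  finally show "verts (map_graph embed (clique_book m k)) = verts (join_K1 (amalgamation m (Suc k)))"
    using m by (simp add: verts_join_amalgamation)
  show "edges (map_graph embed (clique_book m k)) = edges (join_K1 (amalgamation m (Suc k)))"
  proof (intro set_eqI iffI)
    fix e assume "e \<in> edges (map_graph embed (clique_book m k))"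
    then obtain i a b where "i < m" "a < b" "b < k + 2"
      "e = embed ` {page_vertex k i a, page_vertex k i b}"
      by (auto simp: map_graph_def clique_book_def)
    then have "e = {join_vertex (Suc k) (\<rho> i) (\<tau> a), join_vertex (Suc k) (\<rho> i) (\<tau> b)}"
      "\<rho> i < m" "\<tau> a < k + 2" "\<tau> b < k + 2" "\<tau> a \<noteq> \<tau> b"
      using tau_less by (simp_all add: embed_page_vertex rho_less tau_eq_iff)
    then show "e \<in> edges (join_K1 (amalgamation m (Suc k)))"
      using m by (simp add: edges_join_amalgamation) blast
  next
    fix e assume "e \<in> edges (join_K1 (amalgamation m (Suc k)))"
    then obtain i a b where *: "i < m" "a < k + 2" "b < k + 2" "a \<noteq> b"
      "e = {join_vertex (Suc k) i a, join_vertex (Suc k) i b}"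
      using m by (auto simp: edges_join_amalgamation)
    obtain i' where i': "i' < m" "\<rho> i' = i"
      using rho_surj * by blast
    obtain a' where a': "a' < k + 2" "\<tau> a' = a"
      using tau_surj * by blast
    obtain b' where b': "b' < k + 2" "\<tau> b' = b"
      using tau_surj * by blast
    have "{page_vertex k i' a', page_vertex k i' b'} \<in> edges (clique_book m k)"
      using i' a' b' * by (intro edge_clique_book) auto
    moreover have "e = embed ` {page_vertex k i' a', page_vertex k i' b'}"
      using i' a' b' * by (simp add: embed_page_vertex)
    ultimately show "e \<in> edges (map_graph embed (clique_book m k))"
      unfolding map_graph_def graph.simps by (rule image_eqI[rotated])
  qed
qed simp

lemma chi_la_join_eq_book: "chi_la (join_K1 (amalgamation m (Suc k))) = chi_la (clique_book m k)"
  using chi_la_map_graph[OF simple_clique_book inj_on_embed] by (simp only: map_graph_embed)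

lemma chi_la_join_delete_edge_eq_book:
  assumes "a < k + 2" "b < k + 2" "a \<noteq> b"
    and e: "Some ` e = {join_vertex (Suc k) (\<rho> 0) (\<tau> a), join_vertex (Suc k) (\<rho> 0) (\<tau> b)}"
  shows "chi_la (join_K1 (delete_edge (amalgamation m (Suc k)) e)) =
    chi_la (delete_edge (clique_book m k) {page_vertex k 0 a, page_vertex k 0 b})"
proof -
  let ?e = "{page_vertex k 0 a, page_vertex k 0 b}"
  have "?e \<in> edges (clique_book m k)"
    using assms m by (intro edge_clique_book) auto
  from delete_edge_map_graph[OF simple_clique_book inj_on_embed this]
  have "delete_edge (join_K1 (amalgamation m (Suc k))) (embed ` ?e) = map_graph embed (delete_edge (clique_book m k) ?e)"
    by (simp only: map_graph_embed)
  moreover have "embed ` ?e = Some ` e"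
    using assms by (simp add: embed_page_vertex)
  moreover have "chi_la (map_graph embed (delete_edge (clique_book m k) ?e)) = chi_la (delete_edge (clique_book m k) ?e)"
    using inj_on_embed by (intro chi_la_map_graph simple_delete_edge simple_clique_book) (simp add: delete_edge_def)
  ultimately show ?thesis
    by (simp only: delete_edge_join_K1)
qed

end

lemma bij_betw_transpose:
  assumes "bij_betw f A B" "x \<in> B" "y \<in> B"
  shows "bij_betw (transpose x y \<circ> f) A B"
  using assms by (intro bij_betw_trans[OF assms(1)]) simp

text \<open>Starting from the shift that sends the hub \<open>k\<close> to the common vertex \<open>0\<close>, transpositions adjust the
  images of the positions \<open>0\<close> and, below, \<open>1\<close>.\<close>

lemma index_permutation_one:
  assumes "0 < a" "a \<le> k"
  obtains \<tau> where "bij_betw \<tau> {..<k + 2} {..<k + 2}" "\<tau> 0 = a" "\<tau> k = 0" "\<tau> (Suc k) = Suc k"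
proof
  let ?\<sigma> = "\<lambda>x. if x < k then Suc x else if x = k then 0 else x"
  have "inj_on ?\<sigma> {..<k + 2}"
    by (auto simp: inj_on_def split: if_splits)
  moreover from this have "?\<sigma> ` {..<k + 2} = {..<k + 2}"
    by (intro endo_inj_surj) auto
  ultimately show "bij_betw (transpose 1 a \<circ> ?\<sigma>) {..<k + 2} {..<k + 2}"
    using assms by (intro bij_betw_transpose) (auto simp: bij_betw_def)
  show "(transpose 1 a \<circ> ?\<sigma>) 0 = a" "(transpose 1 a \<circ> ?\<sigma>) k = 0" "(transpose 1 a \<circ> ?\<sigma>) (Suc k) = Suc k"
    using assms by auto
qed

lemma index_permutation_two:
  assumes a: "0 < a" "a \<le> k" and b: "0 < b" "b \<le> k" and "a \<noteq> b"
  obtains \<tau> where "bij_betw \<tau> {..<k + 2} {..<k + 2}" "\<tau> 0 = a" "\<tau> 1 = b" "\<tau> k = 0" "\<tau> (Suc k) = Suc k"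
proof -
  obtain \<sigma> where \<sigma>: "bij_betw \<sigma> {..<k + 2} {..<k + 2}" "\<sigma> 0 = a" "\<sigma> k = 0" "\<sigma> (Suc k) = Suc k"
    using index_permutation_one[OF a] .
  have "inj_on \<sigma> {..<k + 2}"
    using \<sigma>(1) by (rule bij_betw_imp_inj_on)
  moreover have "1 < k"
    using assms by linarith
  ultimately have neq: "\<sigma> 1 \<noteq> \<sigma> 0" "\<sigma> 1 \<noteq> \<sigma> k" "\<sigma> 1 \<noteq> \<sigma> (Suc k)"
    by (auto simp: inj_on_eq_iff)
  show ?thesis
  proof
    show "bij_betw (transpose (\<sigma> 1) b \<circ> \<sigma>) {..<k + 2} {..<k + 2}"
      using \<sigma>(1) b bij_betwE[OF \<sigma>(1)] by (intro bij_betw_transpose) auto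
    show "(transpose (\<sigma> 1) b \<circ> \<sigma>) 0 = a" "(transpose (\<sigma> 1) b \<circ> \<sigma>) 1 = b"
      "(transpose (\<sigma> 1) b \<circ> \<sigma>) k = 0" "(transpose (\<sigma> 1) b \<circ> \<sigma>) (Suc k) = Suc k"
      using neq \<sigma> b \<open>a \<noteq> b\<close> by auto
  qed
qed

lemma chi_la_join_amalgamation:
  assumes "2 \<le> m" "2 \<le> n"
  shows "chi_la (join_K1 (amalgamation m n)) = n + 1"
proof -
  obtain k where n_eq: "n = Suc k" "1 \<le> k"
    using assms by (cases n) auto
  obtain \<tau> where perm: "bij_betw \<tau> {..<k + 2} {..<k + 2}" "\<tau> 0 = 1" "\<tau> k = 0" "\<tau> (Suc k) = Suc k"
    using index_permutation_one[of 1 k] n_eq by auto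
  interpret book_embedding m k id \<tau>
    using assms n_eq perm by unfold_locales auto
  show ?thesis
    using chi_la_join_eq_book chi_la_clique_book[of m k] assms n_eq by simp
qed

lemma chi_la_join_delete_inner_edge:
  assumes "2 \<le> m" and e: "e \<in> edges (amalgamation m n)" "common_vertex \<notin> e"
  shows "chi_la (join_K1 (delete_edge (amalgamation m n) e)) = n + 1"
proof -
  obtain i a b where ab: "i < m" "a < n" "b < n" "a \<noteq> b" "e = {amalgam_vertex i a, amalgam_vertex i b}"
    using e by (auto simp: edges_amalgamation)
  then have pos: "0 < a" "0 < b"
    using e by (auto simp: amalgam_vertex_def)
  then obtain k where n_eq: "n = Suc k" "2 \<le> k"
    using ab by (cases n) auto
  obtain \<tau> where perm: "bij_betw \<tau> {..<k + 2} {..<k + 2}" "\<tau> 0 = a" "\<tau> 1 = b" "\<tau> k = 0" "\<tau> (Suc k) = Suc k"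
    using index_permutation_two[of a k b] ab pos n_eq by auto
  interpret book_embedding m k "transpose 0 i" \<tau>
    using assms n_eq perm ab by unfold_locales auto
  have "Some ` e = {join_vertex (Suc k) (transpose 0 i 0) (\<tau> 0), join_vertex (Suc k) (transpose 0 i 0) (\<tau> 1)}"
    using ab n_eq perm by (simp add: join_vertex_def)
  then show ?thesis
    using chi_la_join_delete_edge_eq_book[of 0 1 e] chi_la_clique_book_delete_inner[of m k] assms n_eq by simp
qed

text \<open>Covers \<open>n = 2\<close> as well, where every edge of the amalgamation contains the common vertex.\<close>

lemma chi_la_join_delete_outer_edge:
  assumes "2 \<le> m" and e: "e \<in> edges (amalgamation m n)" "common_vertex \<in> e"
  shows "chi_la (join_K1 (delete_edge (amalgamation m n) e)) = n + 1"
proof -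
  obtain i a b where ab: "i < m" "a < n" "b < n" "a \<noteq> b" "e = {amalgam_vertex i a, amalgam_vertex i b}"
    using e by (auto simp: edges_amalgamation)
  then have "a = 0 \<or> b = 0"
    using e by (auto simp: amalgam_vertex_def common_vertex_def split: if_splits)
  then obtain c where c: "0 < c" "c < n" "e = {amalgam_vertex i c, amalgam_vertex i 0}"
    using ab by (auto simp: insert_commute)
  then obtain k where n_eq: "n = Suc k" "1 \<le> k"
    by (cases n) auto
  obtain \<tau> where perm: "bij_betw \<tau> {..<k + 2} {..<k + 2}" "\<tau> 0 = c" "\<tau> k = 0" "\<tau> (Suc k) = Suc k"
    using index_permutation_one[of c k] c n_eq by auto
  interpret book_embedding m k "transpose 0 i" \<tau>
    using assms n_eq perm ab by unfold_locales auto
  have "Some ` e = {join_vertex (Suc k) (transpose 0 i 0) (\<tau> 0), join_vertex (Suc k) (transpose 0 i 0) (\<tau> k)}"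
    using c n_eq perm by (simp add: join_vertex_def)
  then show ?thesis
    using chi_la_join_delete_edge_eq_book[of 0 k e] chi_la_clique_book_delete_outer[of m k] assms n_eq by simp
qed

theorem theorem3p7:
  shows "(\<forall>m n. m \<ge> 2 \<and> n \<ge> 2 \<longrightarrow> chi_la (join_K1 (amalgamation m n)) = n + 1) \<and>
    (\<forall>m e. m \<ge> 2 \<and> e \<in> edges (amalgamation m 2) \<longrightarrow>
       chi_la (join_K1 (delete_edge (amalgamation m 2) e)) = 3) \<and>
    (\<forall>m n e. m \<ge> 2 \<and> n \<ge> 3 \<and> e \<in> edges (amalgamation m n) \<and> common_vertex \<notin> e \<longrightarrow>
       chi_la (join_K1 (delete_edge (amalgamation m n) e)) = n + 1) \<and>
    (\<forall>m n e. m \<ge> 3 \<and> n \<ge> 3 \<and> e \<in> edges (amalgamation m n) \<and> common_vertex \<in> e \<longrightarrow>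
       chi_la (join_K1 (delete_edge (amalgamation m n) e)) = n + 1)"
proof (intro conjI allI impI; elim conjE)
  fix m n :: nat assume "2 \<le> m" "2 \<le> n"
  then show "chi_la (join_K1 (amalgamation m n)) = n + 1"
    by (rule chi_la_join_amalgamation)
next
  fix m e assume "2 \<le> m" and e: "e \<in> edges (amalgamation m 2)"
  have "common_vertex \<in> e"
    using e by (auto simp: edges_amalgamation amalgam_vertex_def less_2_cases_iff)
  then show "chi_la (join_K1 (delete_edge (amalgamation m 2) e)) = 3"
    using chi_la_join_delete_outer_edge[OF \<open>2 \<le> m\<close> e] by simp
next
  fix m n e assume "2 \<le> m" "e \<in> edges (amalgamation m n)" "common_vertex \<notin> e"
  then show "chi_la (join_K1 (delete_edge (amalgamation m n) e)) = n + 1"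
    by (rule chi_la_join_delete_inner_edge)
next
  fix m n e assume "3 \<le> m" "e \<in> edges (amalgamation m n)" "common_vertex \<in> e"
  then show "chi_la (join_K1 (delete_edge (amalgamation m n) e)) = n + 1"
    by (intro chi_la_join_delete_outer_edge) auto
qed

end
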